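(* Let $g:(0,\infty)\to\mathbb{C}$ be continuous with $g\in L^1(0,\infty)$. Then there exist two solutions $u_1$ and $u_2$ of $$u''(x)=(-1+g(x))\,u(x),\qquad x\in(0,\infty),$$ such that, as $x\to\infty$, $$e^{-ix}u_1(x)\to 1,\qquad e^{-ix}u_1'(x)\to i,$$ $$e^{ix}u_2(x)\to 1,\qquad e^{ix}u_2'(x)\to -i.$$
   Context: A solution is a twice continuously differentiable complex-valued function on $(0,\infty)$ satisfying the equation pointwise. $L^1(I)$ denotes the absolutely integrable functions on the interval $I$. *)

theory Defs
  imports "HOL-Analysis.Analysis"
begin

abbreviation vderiv :: "(real \<Rightarrow> complex) \<Rightarrow> real \<Rightarrow> complex"
  where "vderiv u x \<equiv> vector_derivative u (at x)"

(* Solutions of u'' = q u on (0, oo).  Functions are total on the reals, but since the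
   half-line is open, at x > 0 the two-sided derivatives depend only on the values on (0, oo). *)
definition is_solution :: "(real \<Rightarrow> complex) \<Rightarrow> (real \<Rightarrow> complex) \<Rightarrow> bool"
  where "is_solution q u \<longleftrightarrow>
    u C1_differentiable_on {0<..} \<and> vderiv u C1_differentiable_on {0<..} \<and>
    (\<forall>x>0. vderiv (vderiv u) x = q x * u x)"

end

theory Submission
  imports Defs
begin

text \<open>
  For \<open>\<phi>\<close> equal to \<open>exp (\<plusminus> \<i> x)\<close>, variation of constants from infinity turns the differential
  equation into the Volterra equation
  \<open>u x = \<phi> x + \<integral>\<^bsub>x\<^esub>\<^bsup>\<infinity>\<^esup> sin (t - x) g t u t dt\<close>. With \<open>P x = \<integral>\<^bsub>x\<^esub>\<^bsup>\<infinity>\<^esup> \<bar>g\<bar>\<close>, its right-hand side is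
  a contraction with constant 1/2 for the supremum norm weighted by \<open>exp (- 2 P)\<close>, because
  \<open>exp (2 P) \<bar>g\<bar>\<close> is minus the derivative of \<open>exp (2 P) / 2\<close>. Since \<open>g\<close> is integrable up to 0, this
  works on the whole half-line at once, and extending \<open>g\<close> by 0 even on the whole real line. For the
  bounded fixed point \<open>u\<close>, the differences \<open>u - \<phi>\<close> and \<open>u' - \<phi>'\<close> are tails of convergent integrals.
\<close>

section \<open>Integrals over half-lines \<open>{x..}\<close> as functions of
  \<open>x\<close>\<close>

lemma integrable_on_if_abs_integrable_UNIV:
  fixes h :: "real \<Rightarrow> 'a::euclidean_space"
  assumes "h absolutely_integrable_on UNIV" "S \<in> sets lebesgue"
  shows "h integrable_on S"
  using assms set_integrable_subset[of lebesgue UNIV h S] set_lebesgue_integral_eq_integral(1) by auto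

lemma tail_integral_split:
  fixes h :: "real \<Rightarrow> 'a::euclidean_space"
  assumes "h absolutely_integrable_on UNIV" "a \<le> x"
  shows "integral {x..} h = integral {a..} h - integral {a..x} h"
proof -
  have "{a..x} \<union> {x..} = {a..}" "{a..x} \<inter> {x..} = {x}"
    using assms(2) by auto
  then have "integral {a..} h = integral {a..x} h + integral {x..} h"
    using integral_Un[of h "{a..x}" "{x..}"] integrable_on_if_abs_integrable_UNIV[OF assms(1)]
    by auto
  then show ?thesis by simp
qed

lemma isCont_tail_integral:
  fixes h :: "real \<Rightarrow> 'a::euclidean_space"
  assumes "h absolutely_integrable_on UNIV"
  shows "isCont (\<lambda>x. integral {x..} h) x"
proof -
  have "continuous_on {x-1..x+1} (\<lambda>y. integral {x-1..y} h)"
    by (intro indefinite_integral_continuous_1 integrable_on_if_abs_integrable_UNIV[OF assms]) auto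
  then have "continuous_on {x-1..x+1} (\<lambda>y. integral {x-1..} h - integral {x-1..y} h)"
    by (intro continuous_intros)
  moreover have "integral {y..} h = integral {x-1..} h - integral {x-1..y} h" if "y \<in> {x-1..x+1}" for y
    using that by (intro tail_integral_split[OF assms]) auto
  ultimately have "continuous_on {x-1..x+1} (\<lambda>y. integral {y..} h)"
    by (metis (no_types, lifting) continuous_on_cong)
  then have "continuous_on {x-1<..<x+1} (\<lambda>y. integral {y..} h)"
    by (rule continuous_on_subset) auto
  then show ?thesis
    by (simp add: continuous_on_eq_continuous_at)
qed

text \<open>Near \<open>x\<close> the tail is the constant \<open>integral {x-1..} h\<close> minus
  an indefinite integral, so the fundamental theorem of calculus applies. Continuity is asked only
  at the one point \<open>x\<close>, so that an \<open>h\<close> with a jump elsewhere is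
  covered.\<close>

lemma tail_integral_has_vector_derivative:
  fixes h :: "real \<Rightarrow> 'a::euclidean_space"
  assumes h: "h absolutely_integrable_on UNIV" and "isCont h x"
  shows "((\<lambda>x. integral {x..} h) has_vector_derivative - h x) (at x)"
proof -
  have "((\<lambda>y. integral {x-1..y} h) has_vector_derivative h x) (at x within ({x-1..x+1} - {}))"
    using assms(2)
    by (intro integral_has_vector_derivative_continuous_at integrable_on_if_abs_integrable_UNIV[OF h])
       (auto intro: continuous_at_imp_continuous_at_within)
  then have "((\<lambda>y. integral {x-1..y} h) has_vector_derivative h x) (at x)"
    using at_within_Icc_at[of "x-1" x "x+1"] by auto
  then have "((\<lambda>y. integral {x-1..} h - integral {x-1..y} h) has_vector_derivative 0 - h x) (at x)"
    by (intro derivative_intros)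
  then have "((\<lambda>y. integral {y..} h) has_vector_derivative 0 - h x) (at x)"
    by (rule has_vector_derivative_transform_within_open[where S="{x-1<..}"])
       (auto intro!: tail_integral_split[OF h, symmetric])
  then show ?thesis by simp
qed

lemma tail_integral_tendsto_0:
  fixes h :: "real \<Rightarrow> 'a::euclidean_space"
  assumes h: "h absolutely_integrable_on UNIV"
  shows "((\<lambda>x. integral {x..} h) \<longlongrightarrow> 0) at_top"
proof -
  have set: "set_integrable lebesgue S h" if "S \<in> sets lebesgue" for S
    using set_integrable_subset[OF h that] by simp
  have "((\<lambda>b. set_lebesgue_integral lebesgue {0..b} h)
      \<longlongrightarrow> set_lebesgue_integral lebesgue {0..} h) at_top"
    by (intro tendsto_set_lebesgue_integral_at_top set) auto
  then have "((\<lambda>b. integral {0..b} h) \<longlongrightarrow> integral {0..} h) at_top"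
    by (simp add: set_lebesgue_integral_eq_integral(2)[OF set])
  then have "((\<lambda>b. integral {0..} h - integral {0..b} h) \<longlongrightarrow> integral {0..} h - integral {0..} h) at_top"
    by (intro tendsto_intros)
  moreover have "\<forall>\<^sub>F b in at_top. integral {0..} h - integral {0..b} h = integral {b..} h"
    using eventually_ge_at_top[of 0] by eventually_elim (rule tail_integral_split[OF h, symmetric])
  ultimately show ?thesis
    by (simp add: tendsto_cong)
qed

text \<open>Since \<open>P' = - p\<close>, both sides have derivative
  \<open>- exp (2 * P x) * p x\<close> away from \<open>c\<close>, and both vanish at infinity. The
  exceptional point \<open>c\<close> makes room for the jump that can arise when a function on the
  half-line is extended by 0.\<close>

lemma tail_integral_exp_tail:
  fixes p :: "real \<Rightarrow> real"
  assumes p: "p absolutely_integrable_on UNIV" and cont: "\<And>x. x \<noteq> c \<Longrightarrow> isCont p x"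
  defines "P \<equiv> \<lambda>x. integral {x..} p"
  assumes pe: "(\<lambda>t. exp (2 * P t) * p t) absolutely_integrable_on UNIV"
  shows "integral {x..} (\<lambda>t. exp (2 * P t) * p t) = (exp (2 * P x) - 1) / 2"
proof -
  let ?q = "\<lambda>t. exp (2 * P t) * p t"
  \<comment> \<open>Up to the constant 1/2, \<open>F\<close> is the difference of the two sides; the
    claim becomes \<open>F x = - 1/2\<close>.\<close>
  define F where "F = (\<lambda>x. integral {x..} ?q - exp (2 * P x) / 2)"
  have contP: "isCont P x" for x
    unfolding P_def by (rule isCont_tail_integral[OF p])
  have contF: "continuous_on UNIV F"
    unfolding F_def
    by (intro continuous_at_imp_continuous_on ballI continuous_intros isCont_tail_integral[OF pe] contP) auto
  have derF: "(F has_derivative (\<lambda>h. 0)) (at y within UNIV)" if "y \<in> UNIV - {c}" for y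
  proof -
    have "(P has_vector_derivative - p y) (at y)"
      unfolding P_def using that by (intro tail_integral_has_vector_derivative p cont) auto
    then have dP: "(P has_real_derivative - p y) (at y)"
      by (simp add: has_real_derivative_iff_has_vector_derivative)
    have "((\<lambda>x. integral {x..} ?q) has_vector_derivative - ?q y) (at y)"
      using that by (intro tail_integral_has_vector_derivative pe continuous_intros contP cont) auto
    then have dq: "((\<lambda>x. integral {x..} ?q) has_real_derivative - ?q y) (at y)"
      by (simp add: has_real_derivative_iff_has_vector_derivative)
    have "(F has_real_derivative 0) (at y)"
      unfolding F_def by (rule derivative_eq_intros dq dP refl | simp)+
    then show ?thesis
      by (auto simp: has_field_derivative_def elim!: has_derivative_eq_rhs)
  qed
  have const: "F y = F x" for y
    \<comment> \<open>The derivative vanishes off the finite set \<open>{c}\<close>, and continuity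
      of \<open>F\<close> bridges the point \<open>c\<close>.\<close>
    using has_derivative_zero_unique_strong_connected[OF connected_UNIV open_UNIV _ contF UNIV_I refl derF UNIV_I]
    by (metis finite.emptyI finite.insertI)
  have "(F \<longlongrightarrow> 0 - exp (2 * 0) / 2) at_top"
    unfolding F_def P_def
    by (intro tendsto_intros tail_integral_tendsto_0 p pe[unfolded P_def]) auto
  moreover have "(F \<longlongrightarrow> F x) at_top"
    using const by (metis (no_types, lifting) tendsto_const ext)
  ultimately have "F x = - 1/2"
    using tendsto_unique[of at_top F "F x" "0 - exp (2 * 0) / 2"] by simp
  then show ?thesis
    by (simp add: F_def field_simps)
qed

section \<open>Tail integrals with the kernels \<open>sin (t - x)\<close> and
  \<open>cos (t - x)\<close>\<close>

text \<open>A continuous bounded factor is measurable and bounded, hence preserves absolute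
  integrability. In the role of \<open>f\<close> appear the trigonometric kernels, the exponential
  weight and the fixed point itself.\<close>

lemma abs_integrable_bounded_continuous_mult:
  fixes f :: "real \<Rightarrow> 'a::{euclidean_space,real_normed_algebra}"
  assumes "continuous_on UNIV f" "bounded (range f)" "h absolutely_integrable_on UNIV"
  shows "(\<lambda>t. f t * h t) absolutely_integrable_on UNIV"
  by (intro absolutely_integrable_bounded_measurable_product[where h="(*)"] assms
      continuous_imp_measurable_on_sets_lebesgue bounded_bilinear_mult[THEN bilinear_conv_bounded_bilinear[THEN iffD2]])
    auto

text \<open>Variation of constants from infinity: for continuous integrable \<open>h\<close> this is
  the solution of \<open>y'' + y = h\<close> that tends to 0 at infinity together with its
  derivative, and that derivative is \<open>- cosine_tail h\<close>.\<close>

definition sine_tail :: "(real \<Rightarrow> complex) \<Rightarrow> real \<Rightarrow> complex" where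
  "sine_tail h x = integral {x..} (\<lambda>t. of_real (sin (t - x)) * h t)"

definition cosine_tail :: "(real \<Rightarrow> complex) \<Rightarrow> real \<Rightarrow> complex" where
  "cosine_tail h x = integral {x..} (\<lambda>t. of_real (cos (t - x)) * h t)"

context
  fixes h :: "real \<Rightarrow> complex"
  assumes h: "h absolutely_integrable_on UNIV"
begin

lemma abs_integrable_sin: "(\<lambda>t. of_real (sin (t + c)) * h t) absolutely_integrable_on UNIV"
  by (rule abs_integrable_bounded_continuous_mult[OF _ _ h])
     (auto intro!: continuous_intros boundedI[where B=1])

lemma abs_integrable_cos: "(\<lambda>t. of_real (cos (t + c)) * h t) absolutely_integrable_on UNIV"
  by (rule abs_integrable_bounded_continuous_mult[OF _ _ h])
     (auto intro!: continuous_intros boundedI[where B=1])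

lemma norm_sine_tail_le: "norm (sine_tail h x) \<le> integral {x..} (\<lambda>t. norm (h t))"
  unfolding sine_tail_def
  using abs_integrable_sin[of "-x"] absolutely_integrable_norm[OF h]
  by (intro integral_norm_bound_integral integrable_on_if_abs_integrable_UNIV)
     (auto simp: norm_mult o_def intro!: mult_left_le_one_le)

lemma norm_cosine_tail_le: "norm (cosine_tail h x) \<le> integral {x..} (\<lambda>t. norm (h t))"
  unfolding cosine_tail_def
  using abs_integrable_cos[of "-x"] absolutely_integrable_norm[OF h]
  by (intro integral_norm_bound_integral integrable_on_if_abs_integrable_UNIV)
     (auto simp: norm_mult o_def intro!: mult_left_le_one_le)

lemma sine_tail_tendsto_0: "(sine_tail h \<longlongrightarrow> 0) at_top"
  by (rule tendsto_0_le[where K=1, OF tail_integral_tendsto_0[OF absolutely_integrable_norm[OF h]]])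
     (auto simp: o_def intro!: always_eventually order_trans[OF norm_sine_tail_le])

lemma cosine_tail_tendsto_0: "(cosine_tail h \<longlongrightarrow> 0) at_top"
  by (rule tendsto_0_le[where K=1, OF tail_integral_tendsto_0[OF absolutely_integrable_norm[OF h]]])
     (auto simp: o_def intro!: always_eventually order_trans[OF norm_cosine_tail_le])

text \<open>The variable \<open>x\<close> enters both the domain and the integrand. The addition
  formula pulls it out of the integrand, so that continuity and derivatives follow from the product
  rule for plain tails, without differentiating under the integral sign.\<close>

lemma sine_tail_expand:
  "sine_tail h = (\<lambda>x. of_real (cos x) * integral {x..} (\<lambda>t. of_real (sin t) * h t) -
     of_real (sin x) * integral {x..} (\<lambda>t. of_real (cos t) * h t))"
proof
  fix x
  have int: "(\<lambda>t. of_real (sin t) * h t) integrable_on {x..}" "(\<lambda>t. of_real (cos t) * h t) integrable_on {x..}"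
    using integrable_on_if_abs_integrable_UNIV[OF abs_integrable_sin[of 0]]
      integrable_on_if_abs_integrable_UNIV[OF abs_integrable_cos[of 0]] by auto
  have "sine_tail h x = integral {x..} (\<lambda>t. of_real (cos x) * (of_real (sin t) * h t) - of_real (sin x) * (of_real (cos t) * h t))"
    by (simp add: sine_tail_def sin_diff algebra_simps)
  also have "\<dots> = of_real (cos x) * integral {x..} (\<lambda>t. of_real (sin t) * h t) -
     of_real (sin x) * integral {x..} (\<lambda>t. of_real (cos t) * h t)"
    by (subst integral_diff) (auto intro!: integrable_on_mult_right int)
  finally show "sine_tail h x = \<dots>" .
qed

lemma cosine_tail_expand:
  "cosine_tail h = (\<lambda>x. of_real (cos x) * integral {x..} (\<lambda>t. of_real (cos t) * h t) +
     of_real (sin x) * integral {x..} (\<lambda>t. of_real (sin t) * h t))"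
proof
  fix x
  have int: "(\<lambda>t. of_real (sin t) * h t) integrable_on {x..}" "(\<lambda>t. of_real (cos t) * h t) integrable_on {x..}"
    using integrable_on_if_abs_integrable_UNIV[OF abs_integrable_sin[of 0]]
      integrable_on_if_abs_integrable_UNIV[OF abs_integrable_cos[of 0]] by auto
  have "cosine_tail h x = integral {x..} (\<lambda>t. of_real (cos x) * (of_real (cos t) * h t) + of_real (sin x) * (of_real (sin t) * h t))"
    by (simp add: cosine_tail_def cos_diff algebra_simps)
  also have "\<dots> = of_real (cos x) * integral {x..} (\<lambda>t. of_real (cos t) * h t) +
     of_real (sin x) * integral {x..} (\<lambda>t. of_real (sin t) * h t)"
    by (subst integral_add) (auto intro!: integrable_on_mult_right int)
  finally show "cosine_tail h x = \<dots>" .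
qed

lemma isCont_sine_tail: "isCont (sine_tail h) x"
  unfolding sine_tail_expand
  using abs_integrable_sin[of 0] abs_integrable_cos[of 0]
  by (intro continuous_intros isCont_tail_integral) auto

text \<open>Moving the endpoint contributes minus the kernel at \<open>t = x\<close> times
  \<open>h x\<close>: nothing for the sine, as \<open>sin 0 = 0\<close>, and \<open>- h x\<close>
  for the cosine, as \<open>cos 0 = 1\<close>.\<close>

lemma tail_has_vector_derivative:
  assumes "isCont h x"
  shows "(sine_tail h has_vector_derivative - cosine_tail h x) (at x)"
    and "(cosine_tail h has_vector_derivative sine_tail h x - h x) (at x)"
proof -
  have s: "((\<lambda>x. integral {x..} (\<lambda>t. of_real (sin t) * h t)) has_vector_derivative
      - (of_real (sin x) * h x)) (at x)"
    using abs_integrable_sin[of 0] assms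
    by (intro tail_integral_has_vector_derivative continuous_intros) auto
  have c: "((\<lambda>x. integral {x..} (\<lambda>t. of_real (cos t) * h t)) has_vector_derivative
      - (of_real (cos x) * h x)) (at x)"
    using abs_integrable_cos[of 0] assms
    by (intro tail_integral_has_vector_derivative continuous_intros) auto
  have sin: "((\<lambda>x. complex_of_real (sin x)) has_vector_derivative of_real (cos x)) (at x)"
    by (intro has_vector_derivative_of_real) (auto intro!: derivative_eq_intros)
  have cos: "((\<lambda>x. complex_of_real (cos x)) has_vector_derivative of_real (- sin x)) (at x)"
    by (intro has_vector_derivative_of_real) (auto intro!: derivative_eq_intros)
  have sq: "of_real (sin x) * of_real (sin x) + of_real (cos x) * of_real (cos x) = (1::complex)"
    by (metis of_real_1 of_real_add of_real_mult power2_eq_square sin_cos_squared_add)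
  show "(sine_tail h has_vector_derivative - cosine_tail h x) (at x)"
    unfolding sine_tail_expand cosine_tail_expand
    by (rule has_vector_derivative_eq_rhs[OF has_vector_derivative_diff[OF
          has_vector_derivative_mult[OF cos s] has_vector_derivative_mult[OF sin c]]])
       (simp add: algebra_simps)
  \<comment> \<open>The endpoint terms of the two products in \<open>cosine_tail_expand\<close> add
    up to exactly this form of \<open>- h x\<close>.\<close>
  have "- h x = - ((of_real (sin x) * of_real (sin x) + of_real (cos x) * of_real (cos x)) * h x)"
    by (simp add: sq)
  then show "(cosine_tail h has_vector_derivative sine_tail h x - h x) (at x)"
    unfolding sine_tail_expand cosine_tail_expand
    by - (rule has_vector_derivative_eq_rhs[OF has_vector_derivative_add[OF
          has_vector_derivative_mult[OF cos c] has_vector_derivative_mult[OF sin s]]],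
        simp add: algebra_simps)
qed

end

section \<open>The Volterra equation by a weighted contraction\<close>

lemma sine_tail_diff:
  assumes "h absolutely_integrable_on UNIV" "k absolutely_integrable_on UNIV"
  shows "sine_tail h x - sine_tail k x = sine_tail (\<lambda>t. h t - k t) x"
  using integrable_on_if_abs_integrable_UNIV[OF abs_integrable_sin[OF assms(1), of "-x"]]
    integrable_on_if_abs_integrable_UNIV[OF abs_integrable_sin[OF assms(2), of "-x"]]
  by (simp add: sine_tail_def algebra_simps flip: integral_diff)

text \<open>The weighted norm is encoded by the substitution \<open>u = E * v\<close> with
  \<open>E = exp (2 * P)\<close>: the weighted norm of \<open>u\<close> is the plain supremum norm
  of \<open>v\<close>, so the Banach fixed point theorem applies in the complete space of bounded
  continuous functions.\<close>

lemma sine_tail_fixed_point: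
  fixes h \<phi> :: "real \<Rightarrow> complex"
  assumes h: "h absolutely_integrable_on UNIV" and cont: "\<And>x. x \<noteq> c \<Longrightarrow> isCont h x"
    and \<phi>: "continuous_on UNIV \<phi>" "bounded (range \<phi>)"
  obtains u where "continuous_on UNIV u" "bounded (range u)"
    "\<And>x. u x = \<phi> x + sine_tail (\<lambda>t. h t * u t) x"
proof -
  define P where "P = (\<lambda>x. integral {x..} (\<lambda>t. norm (h t)))"
  have nh: "(\<lambda>t. norm (h t)) absolutely_integrable_on UNIV"
    using absolutely_integrable_norm[OF h] by (simp add: o_def)
  have int_nh: "(\<lambda>t. norm (h t)) integrable_on S" if "S \<in> sets lebesgue" for S
    using integrable_on_if_abs_integrable_UNIV[OF nh that] .
  have P0: "P x \<ge> 0" for x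
    unfolding P_def by (intro integral_nonneg int_nh) auto
  \<comment> \<open>The total mass of \<open>norm h\<close> confines the weight to
    \<open>1 \<le> E x \<le> exp (2 * C)\<close>, so \<open>u\<close> is bounded as soon as
    \<open>v\<close> is.\<close>
  define C where "C = integral UNIV (\<lambda>t. norm (h t))"
  have PC: "P x \<le> C" for x
    unfolding P_def C_def by (intro integral_subset_le int_nh) auto
  have contP: "continuous_on UNIV P"
    unfolding P_def by (intro continuous_at_imp_continuous_on ballI isCont_tail_integral nh)
  define E where "E = (\<lambda>x. exp (2 * P x))"
  have contE: "continuous_on UNIV E"
    unfolding E_def by (intro continuous_intros contP)
  have E1: "E x \<ge> 1" for x
    using P0[of x] by (simp add: E_def)
  have EC: "E x \<le> exp (2 * C)" for x
    using PC[of x] by (simp add: E_def)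
  have Enz: "E x \<noteq> 0" for x
    using E1[of x] by auto
  have pe: "(\<lambda>t. E t * norm (h t)) absolutely_integrable_on UNIV"
    by (rule abs_integrable_bounded_continuous_mult[OF contE _ nh])
       (use E1 EC in \<open>auto intro!: boundedI[where B="exp (2 * C)"] simp: abs_of_nonneg order_trans[OF zero_le_one]\<close>)
  have tailE: "integral {x..} (\<lambda>t. E t * norm (h t)) = (E x - 1) / 2" for x
    using tail_integral_exp_tail[OF nh _ pe[unfolded E_def P_def], of c x] cont
    by (auto simp: E_def P_def intro!: continuous_intros)
  have hE: "(\<lambda>t. h t * (of_real (E t) * v t)) absolutely_integrable_on UNIV"
    if v: "continuous_on UNIV v" "bounded (range v)" for v :: "real \<Rightarrow> complex"
  proof -
    obtain B where B: "\<And>x. norm (v x) \<le> B" using v(2) by (auto simp: bounded_iff)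
    have "(\<lambda>t. (of_real (E t) * v t) * h t) absolutely_integrable_on UNIV"
    proof (rule abs_integrable_bounded_continuous_mult[OF _ _ h])
      show "continuous_on UNIV (\<lambda>t. of_real (E t) * v t)"
        by (intro continuous_intros contE v)
      show "bounded (range (\<lambda>t. of_real (E t) * v t))"
        using EC E1 B
        by (auto intro!: boundedI[where B="exp (2 * C) * B"] mult_mono
              simp: norm_mult abs_of_nonneg order_trans[OF zero_le_one])
    qed
    then show ?thesis by (simp add: mult_ac)
  qed
  \<comment> \<open>Bounding the kernel by 1 and \<open>v\<close> by \<open>d\<close> leaves
    \<open>d\<close> times the tail of \<open>E * norm h\<close>, which \<open>tailE\<close>
    evaluates exactly. This one estimate serves both for the boundedness of the operator's values
    and for the contraction.\<close>
  have bound: "norm (sine_tail (\<lambda>t. h t * (of_real (E t) * v t)) x) \<le> d * (E x - 1) / 2"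
    if v: "continuous_on UNIV v" and d: "\<And>x. norm (v x) \<le> d" for v :: "real \<Rightarrow> complex" and d x
  proof -
    have hv: "(\<lambda>t. h t * (of_real (E t) * v t)) absolutely_integrable_on UNIV"
      using d by (intro hE v) (auto simp: bounded_iff)
    have "norm (sine_tail (\<lambda>t. h t * (of_real (E t) * v t)) x)
        \<le> integral {x..} (\<lambda>t. norm (h t * (of_real (E t) * v t)))"
      by (rule norm_sine_tail_le[OF hv])
    also have "\<dots> \<le> integral {x..} (\<lambda>t. d * (E t * norm (h t)))"
    proof (intro integral_le integrable_on_mult_right integrable_on_if_abs_integrable_UNIV pe)
      show "(\<lambda>t. norm (h t * (of_real (E t) * v t))) absolutely_integrable_on UNIV"
        using absolutely_integrable_norm[OF hv] by (simp add: o_def)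
      show "norm (h t * (of_real (E t) * v t)) \<le> d * (E t * norm (h t))" for t
        using mult_right_mono[OF d[of t], of "E t * norm (h t)"] E1[of t]
        by (simp add: norm_mult mult_ac)
    qed auto
    also have "\<dots> = d * (E x - 1) / 2"
      by (simp add: tailE)
    finally show ?thesis .
  qed
  \<comment> \<open>The Volterra operator conjugated by the weight: multiply by \<open>E\<close>,
    apply the right-hand side of the equation, divide by \<open>E\<close>.\<close>
  define S where "S = (\<lambda>(v :: real \<Rightarrow> complex) x.
      (\<phi> x + sine_tail (\<lambda>t. h t * (of_real (E t) * v t)) x) / of_real (E x))"
  have S: "S (apply_bcontfun v) \<in> bcontfun" for v :: "real \<Rightarrow>\<^sub>C complex"
  proof -
    obtain B where B: "\<And>x. norm (\<phi> x) \<le> B" using \<phi>(2) by (auto simp: bounded_iff)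
    have B0: "B \<ge> 0" using B[of 0] norm_ge_zero order_trans by blast
    \<comment> \<open>Only boundedness matters here, so the bound is crude; the integral part is in
      fact at most \<open>norm v / 2\<close>.\<close>
    have "norm (S v x) \<le> B + norm v" for x
    proof -
      have "norm (S v x) = norm (\<phi> x + sine_tail (\<lambda>t. h t * (of_real (E t) * v t)) x) / E x"
        using E1[of x] by (simp add: S_def norm_divide)
      also have "\<dots> \<le> (B + norm v * (E x - 1) / 2) / E x"
        using E1[of x]
        by (intro divide_right_mono norm_triangle_mono B bound) (auto simp: norm_bounded)
      also have "\<dots> \<le> B + norm v"
      proof -
        have "B \<le> B * E x" "norm v \<le> norm v * E x"
          using mult_left_mono[OF E1[of x]] B0 by fastforce+
        then have "B + norm v * (E x - 1) / 2 \<le> (B + norm v) * E x"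
          using norm_ge_zero[of v] by (simp only: right_diff_distrib distrib_right mult_1_right) argo
        then show ?thesis
          using E1[of x] by (simp add: divide_le_eq)
      qed
      finally show ?thesis .
    qed
    moreover have "continuous_on UNIV (S v)"
      unfolding S_def using Enz
      by (intro continuous_intros \<phi> contE continuous_at_imp_continuous_on[of _ "sine_tail _"]
            ballI isCont_sine_tail hE) auto
    ultimately show ?thesis by (intro bcontfun_normI)
  qed
  define T where "T = (\<lambda>v. Bcontfun (S (apply_bcontfun v)))"
  have T: "apply_bcontfun (T v) = S v" for v
    unfolding T_def using S by (simp add: Bcontfun_inverse)
  have "dist (T v) (T w) \<le> 1/2 * dist v w" for v w
  proof (rule dist_bound)
    fix x
    \<comment> \<open>The inhomogeneity \<open>\<phi>\<close> cancels, and linearity leaves the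
      integral operator applied to \<open>v - w\<close>.\<close>
    have "S v x - S w x = sine_tail (\<lambda>t. h t * (of_real (E t) * (v t - w t))) x / of_real (E x)"
      using sine_tail_diff[OF hE[of v] hE[of w], of x]
      by (simp add: S_def right_diff_distrib flip: diff_divide_distrib)
    then have "dist (T v x) (T w x) =
        norm (sine_tail (\<lambda>t. h t * (of_real (E t) * (v t - w t))) x) / E x"
      using E1[of x] by (simp add: T dist_norm norm_divide)
    also have "\<dots> \<le> (dist v w * (E x - 1) / 2) / E x"
      using E1[of x]
      by (intro divide_right_mono bound continuous_intros)
         (auto simp: dist_bounded simp flip: dist_norm)
    \<comment> \<open>The factor is \<open>(1 - 1 / E x) / 2\<close>, which stays below 1/2 however
      large the integral of \<open>norm h\<close> is.\<close>
    also have "\<dots> \<le> 1/2 * dist v w"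
      using E1[of x] by (simp add: field_simps)
    finally show "dist (T v x) (T w x) \<le> 1/2 * dist v w" .
  qed
  then obtain v where v: "T v = v"
    using banach_fix_type[of "1/2" T] by auto
  \<comment> \<open>Undoing the substitution turns the fixed point of \<open>T\<close> into a
    solution of the original integral equation.\<close>
  define u where "u = (\<lambda>x. of_real (E x) * v x)"
  have "continuous_on UNIV u"
    unfolding u_def by (intro continuous_intros contE continuous_on_apply_bcontfun)
  moreover have "norm (u x) \<le> exp (2 * C) * norm v" for x
    using EC[of x] E1[of x] norm_bounded[of v x]
    by (auto simp: u_def norm_mult intro!: mult_mono)
  then have "bounded (range u)"
    by (intro boundedI[where B="exp (2 * C) * norm v"]) blast
  moreover have "u x = \<phi> x + sine_tail (\<lambda>t. h t * u t) x" for x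
  proof -
    have "v x = S v x" using fun_cong[OF T[of v], of x] unfolding v .
    then have "of_real (E x) * v x = of_real (E x) * S v x" by (rule arg_cong)
    then show ?thesis using Enz[of x] by (simp only: S_def u_def) simp
  qed
  ultimately show ?thesis by (rule that)
qed

section \<open>From the integral equation to the differential equation\<close>

text \<open>The definition speaks of \<open>vderiv u\<close>, known to agree with \<open>u'\<close>
  only for positive arguments. As \<open>{0<..}\<close> is open, this agreement suffices to transfer
  the second derivative, whose continuity follows from that of \<open>q\<close> and
  \<open>u\<close>.\<close>

lemma is_solutionI:
  assumes u: "\<And>x. x > 0 \<Longrightarrow> (u has_vector_derivative u' x) (at x)"
    and u': "\<And>x. x > 0 \<Longrightarrow> (u' has_vector_derivative q x * u x) (at x)"
    and q: "continuous_on {0<..} q"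
  shows "is_solution q u"
proof -
  have eq: "vderiv u x = u' x" if "x > 0" for x
    using u[OF that] by (rule vector_derivative_at)
  have der: "(vderiv u has_vector_derivative q x * u x) (at x)" if "x > 0" for x
    by (rule has_vector_derivative_transform_within_open[OF u'[OF that], of "{0<..}"])
       (use that eq in auto)
  have cu: "continuous_on {0<..} u"
    by (intro continuous_at_imp_continuous_on) (use u has_vector_derivative_continuous in blast)
  have cu': "continuous_on {0<..} u'"
    by (intro continuous_at_imp_continuous_on) (use u' has_vector_derivative_continuous in blast)
  have "u C1_differentiable_on {0<..}"
    unfolding C1_differentiable_on_def using u cu' by auto
  moreover have "vderiv u C1_differentiable_on {0<..}"
    unfolding C1_differentiable_on_def using der q cu
    by (intro exI[of _ "\<lambda>x. q x * u x"]) (auto intro: continuous_intros)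
  ultimately show ?thesis
    using der by (auto simp: is_solution_def intro: vector_derivative_at)
qed

text \<open>Here \<open>\<phi>\<close> is any bounded solution of \<open>y'' + y = 0\<close>. Adding
  \<open>sine_tail (\<lambda>t. h t * u t)\<close> perturbs it to a solution of the full equation,
  and the correction and its derivative vanish at infinity.\<close>

lemma solution_asymptotic_to:
  fixes g \<phi> \<phi>' :: "real \<Rightarrow> complex"
  assumes g: "continuous_on {0<..} g" "g absolutely_integrable_on {0<..}"
    and \<phi>: "\<And>x. (\<phi> has_vector_derivative \<phi>' x) (at x)" "bounded (range \<phi>)"
    and \<phi>': "\<And>x. (\<phi>' has_vector_derivative - \<phi> x) (at x)"
  obtains u where "is_solution (\<lambda>x. - 1 + g x) u"
    "((\<lambda>x. u x - \<phi> x) \<longlongrightarrow> 0) at_top" "((\<lambda>x. vderiv u x - \<phi>' x) \<longlongrightarrow> 0) at_top"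
proof -
  \<comment> \<open>Extension by 0 keeps absolute integrability and continuity except possibly at 0,
    the exceptional point \<open>c\<close> of the fixed point lemma.\<close>
  define h where "h = (\<lambda>x. if x \<in> {0<..} then g x else 0)"
  have h: "h absolutely_integrable_on UNIV"
    using g(2) unfolding h_def by (simp only: absolutely_integrable_restrict_UNIV)
  have cont: "isCont h x" if "x \<noteq> 0" for x
  proof (cases "x > 0")
    case True
    have "\<forall>\<^sub>F y in nhds x. h y = g y"
      using eventually_nhds_in_open[of "{0<..}" x] True by (auto simp: h_def elim!: eventually_mono)
    then show ?thesis
      using True g(1) by (simp add: isCont_cong continuous_on_eq_continuous_at)
  next
    case False
    have "\<forall>\<^sub>F y in nhds x. h y = 0"
      using eventually_nhds_in_open[of "{..<0}" x] False that by (auto simp: h_def elim!: eventually_mono)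
    then show ?thesis
      by (simp add: isCont_cong)
  qed
  have cphi: "continuous_on UNIV \<phi>"
    by (intro continuous_at_imp_continuous_on) (use \<phi>(1) has_vector_derivative_continuous in blast)
  obtain u where u: "continuous_on UNIV u" "bounded (range u)"
    "\<And>x. u x = \<phi> x + sine_tail (\<lambda>t. h t * u t) x"
    using sine_tail_fixed_point[OF h cont cphi \<phi>(2)] by blast
  have hu: "(\<lambda>t. h t * u t) absolutely_integrable_on UNIV"
    using abs_integrable_bounded_continuous_mult[OF u(1,2) h] by (simp add: mult.commute)
  have ueq: "u = (\<lambda>x. \<phi> x + sine_tail (\<lambda>t. h t * u t) x)"
    using u(3) by blast
  define u' where "u' = (\<lambda>x. \<phi>' x - cosine_tail (\<lambda>t. h t * u t) x)"
  have conthu: "isCont (\<lambda>t. h t * u t) x" if "x > 0" for x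
    using that u(1) by (intro continuous_intros cont) (auto simp: continuous_on_eq_continuous_at)
  have du: "(u has_vector_derivative u' x) (at x)" if "x > 0" for x
    using has_vector_derivative_add[OF \<phi>(1) tail_has_vector_derivative(1)[OF hu conthu[OF that]]]
    by (simp add: u'_def flip: ueq)
  have du': "(u' has_vector_derivative (- 1 + g x) * u x) (at x)" if "x > 0" for x
    \<comment> \<open>The derivative is
      \<open>- \<phi> x - sine_tail (\<lambda>t. h t * u t) x + h x * u x\<close>; by the fixed
      point equation the first two terms make \<open>- u x\<close>, and \<open>h x = g x\<close> for
      positive \<open>x\<close>.\<close>
    using has_vector_derivative_diff[OF \<phi>' tail_has_vector_derivative(2)[OF hu conthu[OF that]]] that
    by (simp add: u'_def u(3)[of x] h_def algebra_simps)
  have "is_solution (\<lambda>x. - 1 + g x) u"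
    by (rule is_solutionI[OF du du']) (auto intro!: continuous_intros g)
  moreover have "((\<lambda>x. u x - \<phi> x) \<longlongrightarrow> 0) at_top"
    using sine_tail_tendsto_0[OF hu] by (subst u(3)) simp
  moreover have "\<forall>\<^sub>F x in at_top. - cosine_tail (\<lambda>t. h t * u t) x = vderiv u x - \<phi>' x"
    using eventually_gt_at_top[of 0]
    by eventually_elim (simp add: vector_derivative_at[OF du] u'_def)
  then have "((\<lambda>x. vderiv u x - \<phi>' x) \<longlongrightarrow> 0) at_top"
    using tendsto_minus[OF cosine_tail_tendsto_0[OF hu]] by (simp add: tendsto_cong)
  ultimately show ?thesis by (rule that)
qed

section \<open>The two oscillating exponentials\<close>

text \<open>The real \<open>s\<close> is 1 or -1 and selects the sign of the exponent, so both
  solutions come from one argument; \<open>s\<^sup>2 = 1\<close> makes the exponential solve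
  \<open>y'' + y = 0\<close>.\<close>

lemma exp_solution_exists:
  fixes g :: "real \<Rightarrow> complex" and s :: real
  assumes g: "continuous_on {0<..} g" "g absolutely_integrable_on {0<..}" and s: "s\<^sup>2 = 1"
  obtains u where "is_solution (\<lambda>x. - 1 + g x) u"
    "((\<lambda>x. exp (- (\<i> * of_real s) * of_real x) * u x) \<longlongrightarrow> 1) at_top"
    "((\<lambda>x. exp (- (\<i> * of_real s) * of_real x) * vderiv u x) \<longlongrightarrow> \<i> * of_real s) at_top"
proof -
  define \<phi> where "\<phi> = (\<lambda>x. exp (\<i> * of_real s * complex_of_real x))"
  have s': "complex_of_real s * of_real s = 1"
    using s by (metis of_real_1 of_real_mult power2_eq_square)
  have d: "(\<phi> has_vector_derivative \<i> * of_real s * \<phi> x) (at x)" for x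
    unfolding \<phi>_def
    by (rule has_vector_derivative_real_field, (rule derivative_eq_intros refl | simp)+)
  have d': "((\<lambda>x. \<i> * of_real s * \<phi> x) has_vector_derivative - \<phi> x) (at x)" for x
  proof -
    have "\<i> * of_real s * (\<i> * of_real s * \<phi> x) = (\<i> * \<i>) * (of_real s * of_real s) * \<phi> x"
      by (simp only: mult_ac)
    also have "\<dots> = - \<phi> x"
      by (simp add: s')
    finally show ?thesis
      using has_vector_derivative_mult_right[OF d, of "\<i> * of_real s" x] by simp
  qed
  have n: "norm (\<phi> x) = 1" for x by (simp add: \<phi>_def norm_exp_eq_Re)
  have b: "bounded (range \<phi>)" by (auto intro!: boundedI[where B=1] simp: n)
  obtain u where u: "is_solution (\<lambda>x. - 1 + g x) u"
    "((\<lambda>x. u x - \<phi> x) \<longlongrightarrow> 0) at_top" "((\<lambda>x. vderiv u x - \<i> * of_real s * \<phi> x) \<longlongrightarrow> 0) at_top"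
    using solution_asymptotic_to[OF g d b d'] by blast
  define e where "e = (\<lambda>x. exp (- (\<i> * of_real s) * complex_of_real x))"
  have e: "norm (e x) = 1" "e x * \<phi> x = 1" for x
    by (simp_all add: e_def \<phi>_def norm_exp_eq_Re flip: exp_add)
  \<comment> \<open>Multiplying by \<open>e\<close>, the inverse of \<open>\<phi>\<close> of modulus
    1, preserves convergence to 0 and turns \<open>a * \<phi> x\<close> into the constant
    \<open>a\<close>. It is used with \<open>a = 1\<close> for \<open>u\<close> and
    \<open>a = \<i> * of_real s\<close> for its derivative.\<close>
  have lim: "((\<lambda>x. e x * f x) \<longlongrightarrow> a) at_top" if "((\<lambda>x. f x - a * \<phi> x) \<longlongrightarrow> 0) at_top" for f a
  proof -
    have "((\<lambda>x. e x * (f x - a * \<phi> x)) \<longlongrightarrow> 0) at_top"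
      by (rule tendsto_0_le[where K=1, OF that]) (simp add: norm_mult e)
    moreover have "e x * (f x - a * \<phi> x) = e x * f x - a" for x
      using e(2)[of x] by (simp add: algebra_simps)
    ultimately show ?thesis by - (rule LIM_zero_cancel, simp)
  qed
  have "((\<lambda>x. e x * u x) \<longlongrightarrow> 1) at_top"
    by (rule lim) (use u(2) in simp)
  moreover have "((\<lambda>x. e x * vderiv u x) \<longlongrightarrow> \<i> * of_real s) at_top"
    by (rule lim) (rule u(3))
  ultimately show ?thesis
    using that[OF u(1)] unfolding e_def by blast
qed

theorem proposition2p2:
  fixes g :: "real \<Rightarrow> complex"
  assumes "continuous_on {0<..} g"
    and "g absolutely_integrable_on {0<..}"
  shows "\<exists>u1 u2. is_solution (\<lambda>x. - 1 + g x) u1 \<and> is_solution (\<lambda>x. - 1 + g x) u2 \<and>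
    ((\<lambda>x. exp (- \<i> * complex_of_real x) * u1 x) \<longlongrightarrow> 1) at_top \<and>
    ((\<lambda>x. exp (- \<i> * complex_of_real x) * vderiv u1 x) \<longlongrightarrow> \<i>) at_top \<and>
    ((\<lambda>x. exp (\<i> * complex_of_real x) * u2 x) \<longlongrightarrow> 1) at_top \<and>
    ((\<lambda>x. exp (\<i> * complex_of_real x) * vderiv u2 x) \<longlongrightarrow> - \<i>) at_top"
proof -
  obtain u1 where "is_solution (\<lambda>x. - 1 + g x) u1"
    "((\<lambda>x. exp (- \<i> * complex_of_real x) * u1 x) \<longlongrightarrow> 1) at_top"
    "((\<lambda>x. exp (- \<i> * complex_of_real x) * vderiv u1 x) \<longlongrightarrow> \<i>) at_top"
    using exp_solution_exists[OF assms, of 1] by auto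
  moreover obtain u2 where "is_solution (\<lambda>x. - 1 + g x) u2"
    "((\<lambda>x. exp (\<i> * complex_of_real x) * u2 x) \<longlongrightarrow> 1) at_top"
    "((\<lambda>x. exp (\<i> * complex_of_real x) * vderiv u2 x) \<longlongrightarrow> - \<i>) at_top"
    using exp_solution_exists[OF assms, of "-1"] by auto
  ultimately show ?thesis by blast
qed

end
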